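(* Let $k$ be an indeterminate and define $$a(k)=10k^2-8k+8,\qquad b(k)=k(k^2-4k+20),\qquad c(k)=(k+2)(k^2-4).$$ Let $E$ be the elliptic curve over $\mathbb{Q}(k)$ given by $$y^2=\big(x+a(k)b(k)\big)\big(x+b(k)c(k)\big)\big(x+a(k)c(k)\big).$$ Then the Mordell–Weil rank of $E(\mathbb{Q}(k))$ is at least $2$. *)

theory Defs
  imports "HOL-Computational_Algebra.Polynomial" "HOL-Computational_Algebra.Fraction_Field"
begin

text \<open>Points of a Weierstrass curve y^2 = x^3 + a2 x^2 + a4 x + a6 over a field
  (characteristic not 2), with the point at infinity as neutral element.\<close>

datatype 'a ecpoint = Infinity | Point 'a 'a

definition on_curve :: "'a::field \<Rightarrow> 'a \<Rightarrow> 'a \<Rightarrow> 'a ecpoint \<Rightarrow> bool" where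
  "on_curve a2 a4 a6 P = (case P of Infinity \<Rightarrow> True
     | Point x y \<Rightarrow> y^2 = x^3 + a2 * x^2 + a4 * x + a6)"

definition ec_points :: "'a::field \<Rightarrow> 'a \<Rightarrow> 'a \<Rightarrow> 'a ecpoint set" where
  "ec_points a2 a4 a6 = {P. on_curve a2 a4 a6 P}"

fun ec_add :: "'a::field \<Rightarrow> 'a \<Rightarrow> 'a \<Rightarrow> 'a ecpoint \<Rightarrow> 'a ecpoint \<Rightarrow> 'a ecpoint" where
  "ec_add a2 a4 a6 Infinity P = P"
| "ec_add a2 a4 a6 P Infinity = P"
| "ec_add a2 a4 a6 (Point x1 y1) (Point x2 y2) =
     (if x1 = x2 \<and> y1 = - y2 then Infinity
      else let l = (if x1 = x2 then (3 * x1^2 + 2 * a2 * x1 + a4) / (2 * y1)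
                    else (y2 - y1) / (x2 - x1));
               x3 = l^2 - a2 - x1 - x2
           in Point x3 (l * (x1 - x3) - y1))"

fun ec_neg :: "'a::field ecpoint \<Rightarrow> 'a ecpoint" where
  "ec_neg Infinity = Infinity"
| "ec_neg (Point x y) = Point x (- y)"

fun ec_nmul :: "'a::field \<Rightarrow> 'a \<Rightarrow> 'a \<Rightarrow> nat \<Rightarrow> 'a ecpoint \<Rightarrow> 'a ecpoint" where
  "ec_nmul a2 a4 a6 0 P = Infinity"
| "ec_nmul a2 a4 a6 (Suc n) P = ec_add a2 a4 a6 P (ec_nmul a2 a4 a6 n P)"

definition ec_mul :: "'a::field \<Rightarrow> 'a \<Rightarrow> 'a \<Rightarrow> int \<Rightarrow> 'a ecpoint \<Rightarrow> 'a ecpoint" where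
  "ec_mul a2 a4 a6 m P =
     (if m \<ge> 0 then ec_nmul a2 a4 a6 (nat m) P else ec_neg (ec_nmul a2 a4 a6 (nat (- m)) P))"

definition ec_lincomb :: "'a::field \<Rightarrow> 'a \<Rightarrow> 'a \<Rightarrow> int list \<Rightarrow> 'a ecpoint list \<Rightarrow> 'a ecpoint" where
  "ec_lincomb a2 a4 a6 cs Ps =
     foldr (ec_add a2 a4 a6) (map2 (ec_mul a2 a4 a6) cs Ps) Infinity"

definition ec_independent :: "'a::field \<Rightarrow> 'a \<Rightarrow> 'a \<Rightarrow> 'a ecpoint list \<Rightarrow> bool" where
  "ec_independent a2 a4 a6 Ps =
     (\<forall>cs. length cs = length Ps \<longrightarrow> ec_lincomb a2 a4 a6 cs Ps = Infinity \<longrightarrow> (\<forall>c\<in>set cs. c = 0))"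

definition ec_rank_at_least :: "'a::field \<Rightarrow> 'a \<Rightarrow> 'a \<Rightarrow> nat \<Rightarrow> bool" where
  "ec_rank_at_least a2 a4 a6 r =
     (\<exists>Ps. length Ps = r \<and> set Ps \<subseteq> ec_points a2 a4 a6 \<and> ec_independent a2 a4 a6 Ps)"

type_synonym ratfun = "rat poly fract"

definition kvar :: ratfun where "kvar = Fract [:0, 1:] 1"

text \<open>Curve y^2 = (x+p)(x+q)(x+r), i.e. a2 = p+q+r, a4 = pq+qr+rp, a6 = pqr.\<close>
definition ec_rank_at_least_roots :: "'a::field \<Rightarrow> 'a \<Rightarrow> 'a \<Rightarrow> nat \<Rightarrow> bool" where
  "ec_rank_at_least_roots p q r n =
     ec_rank_at_least (p + q + r) (p * q + q * r + r * p) (p * q * r) n"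

end

theory Submission
  imports Defs
begin

text \<open>
  Reduce modulo the uniformizer \<open>t = k - 2\<close>. On the kernel of reduction the parameter
  \<open>z = x / y\<close> satisfies \<open>z(P + Q) \<equiv> z(P) + z(Q)\<close> modulo \<open>t\<^sup>3\<close>, because the formal group law of a
  curve \<open>y\<^sup>2 = x\<^sup>3 + a\<^sub>2 x\<^sup>2 + a\<^sub>4 x + a\<^sub>6\<close> has no quadratic terms. So two points of the kernel whose
  parameters have exact order 1 and 2 are independent, without any appeal to associativity of
  the group law.

  Such points come from \<open>P\<^sub>0 = (0, abc)\<close>, the point \<open>Q\<^sub>0\<close> with \<open>x(Q\<^sub>0) = 8k(k\<^sup>2 - 4)\<^sup>2\<close> and the
  2-torsion point \<open>T = (-bc, 0)\<close>: the parameter of \<open>P\<^sub>0 + Q\<^sub>0 + T\<close> has order 1, that of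
  \<open>2P\<^sub>0 + T\<close> has order 2.
\<close>

section \<open>Lines meeting a Weierstrass cubic\<close>

lemma ec_add_Infinity_right [simp]: "ec_add a2 a4 a6 P Infinity = P"
  by (cases P) simp_all

text \<open>Substituting y = l x + m into the curve equation leaves the monic cubic x^3 + (a2 - l^2)
  x^2 + (a4 - 2 l m) x + (a6 - m^2). Its roots are \<open>x1\<close>, \<open>x2\<close>,
  \<open>x3\<close>: the choice of \<open>x3\<close> fixes their sum, and Vieta gives the other two
  symmetric functions.\<close>

lemma chord_vieta:
  fixes x1 x2 y1 y2 :: "'a::field"
  assumes "x1 \<noteq> x2"
    and "y1^2 = x1^3 + a2 * x1^2 + a4 * x1 + a6"
    and "y2^2 = x2^3 + a2 * x2^2 + a4 * x2 + a6"
    and l: "l = (y2 - y1) / (x2 - x1)" and m: "m = y1 - l * x1"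
    and x3: "x3 = l^2 - a2 - x1 - x2"
  shows "y2 = l * x2 + m" "x1 * x2 + x1 * x3 + x2 * x3 = a4 - 2 * l * m"
    "x1 * x2 * x3 = m^2 - a6"
proof -
  have "l * (x2 - x1) = y2 - y1"
    using assms(1) by (simp add: l)
  then show y2: "y2 = l * x2 + m"
    unfolding m by (simp add: algebra_simps)
  have y1: "y1 = l * x1 + m"
    unfolding m by simp
  \<comment> \<open>The difference of the two curve equations is divisible by
    \<open>x2 - x1\<close>.\<close>
  have "(x2 - x1) * (x1 * x2 + x1 * x3 + x2 * x3 - (a4 - 2 * l * m)) = 0"
    using assms(2,3) y1 y2 unfolding x3 by algebra
  then show e2: "x1 * x2 + x1 * x3 + x2 * x3 = a4 - 2 * l * m"
    using assms(1) by simp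
  show "x1 * x2 * x3 = m^2 - a6"
    using assms(2) y1 e2 x3 by algebra
qed

text \<open>Same cubic, now with \<open>x\<close> as a double root: the tangent slope makes its
  derivative vanish at \<open>x\<close>.\<close>

lemma tangent_vieta:
  fixes x y :: "'a::field"
  assumes "(2::'a) \<noteq> 0" "y \<noteq> 0"
    and "y^2 = x^3 + a2 * x^2 + a4 * x + a6"
    and l: "l = (3 * x^2 + 2 * a2 * x + a4) / (2 * y)" and m: "m = y - l * x"
    and x3: "x3 = l^2 - a2 - x - x"
  shows "x * x + x * x3 + x * x3 = a4 - 2 * l * m" "x * x * x3 = m^2 - a6"
proof -
  have ly: "l * (2 * y) = 3 * x^2 + 2 * a2 * x + a4"
    using assms(1,2) by (simp add: l)
  show e2: "x * x + x * x3 + x * x3 = a4 - 2 * l * m"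
    using ly unfolding x3 m by algebra
  show "x * x * x3 = m^2 - a6"
    using assms(3) ly e2 m x3 by algebra
qed

lemma third_intersection_on_curve:
  fixes x1 x2 x3 :: "'a::field"
  assumes "x3 = l^2 - a2 - x1 - x2" "x1 * x2 + x1 * x3 + x2 * x3 = a4 - 2 * l * m"
    "x1 * x2 * x3 = m^2 - a6"
  shows "(l * x3 + m)^2 = x3^3 + a2 * x3^2 + a4 * x3 + a6"
  using assms by algebra

text \<open>The quotient of the second expression by the first is the sum of the three parameters x
  / y. The terms of highest degree in \<open>l\<close> and \<open>m\<close> cancel, leaving forms of
  degree 3 and 2, so for l = k m the quotient is 1 / m times a function of k alone.\<close>

lemma collinear_products:
  fixes x1 x2 x3 :: "'a::field"
  assumes "x3 = l^2 - a2 - x1 - x2" "x1 * x2 + x1 * x3 + x2 * x3 = a4 - 2 * l * m"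
    "x1 * x2 * x3 = m^2 - a6"
    and "y1 = l * x1 + m" "y2 = l * x2 + m" "y3 = l * x3 + m"
  shows "y1 * y2 * y3 = m^3 - a2 * l * m^2 + a4 * l^2 * m - a6 * l^3"
    and "x1 * y2 * y3 + x2 * y1 * y3 + x3 * y1 * y2 = 2 * a4 * l * m - 3 * a6 * l^2 - a2 * m^2"
proof -
  have e1: "x1 + x2 + x3 = l^2 - a2"
    using assms(1) by simp
  have "y1 * y2 * y3 = l^3 * (x1 * x2 * x3) + l^2 * m * (x1 * x2 + x1 * x3 + x2 * x3)
      + l * m^2 * (x1 + x2 + x3) + m^3"
    unfolding assms(4-6) by algebra
  then show "y1 * y2 * y3 = m^3 - a2 * l * m^2 + a4 * l^2 * m - a6 * l^3"
    unfolding e1 assms(2,3) by algebra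
  have "x1 * y2 * y3 + x2 * y1 * y3 + x3 * y1 * y2 = 3 * l^2 * (x1 * x2 * x3)
      + 2 * l * m * (x1 * x2 + x1 * x3 + x2 * x3) + m^2 * (x1 + x2 + x3)"
    unfolding assms(4-6) by algebra
  then show "x1 * y2 * y3 + x2 * y1 * y3 + x3 * y1 * y2 = 2 * a4 * l * m - 3 * a6 * l^2 - a2 * m^2"
    unfolding e1 assms(2,3) by algebra
qed

section \<open>Filtration by powers of a uniformizer\<close>

text \<open>Models a discrete valuation ring with residue characteristic 0: elements congruent to 1
  modulo \<open>t\<close> and nonzero integers are units. For n = 0, \<open>inverse_int\<close>
  reads 0 in R, by the convention \<open>inverse 0 = 0\<close>.\<close>

locale local_subring =
  fixes R :: "'a::field_char_0 set" and t :: 'a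
  assumes one_in: "1 \<in> R" and t_in: "t \<in> R" and t_nonzero: "t \<noteq> 0"
    and add_in: "\<And>f g. f \<in> R \<Longrightarrow> g \<in> R \<Longrightarrow> f + g \<in> R"
    and mult_in: "\<And>f g. f \<in> R \<Longrightarrow> g \<in> R \<Longrightarrow> f * g \<in> R"
    and uminus_in: "\<And>f. f \<in> R \<Longrightarrow> - f \<in> R"
    and inverse_unit: "\<And>f. f \<in> R \<Longrightarrow> 1 + t * f \<noteq> 0 \<and> inverse (1 + t * f) \<in> R"
    and inverse_int: "\<And>n::int. inverse (of_int n) \<in> R"
begin

text \<open>Membership in \<open>I n\<close> expresses that the valuation is at least n.\<close>

definition I :: "nat \<Rightarrow> 'a set" where
  "I n = (\<lambda>f. t^n * f) ` R"

lemma I_0 [simp]: "I 0 = R"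
  by (simp add: I_def)

lemma zero_in: "0 \<in> R"
  using add_in[OF one_in uminus_in[OF one_in]] by simp

lemma I_zero: "0 \<in> I n"
  using zero_in by (force simp: I_def)

lemma I_add: "f \<in> I n \<Longrightarrow> g \<in> I n \<Longrightarrow> f + g \<in> I n"
  by (auto simp: I_def add_in simp flip: distrib_left)

lemma I_uminus: "f \<in> I n \<Longrightarrow> - f \<in> I n"
  using uminus_in by (force simp: I_def image_iff)

lemma I_diff: "f \<in> I n \<Longrightarrow> g \<in> I n \<Longrightarrow> f - g \<in> I n"
  using I_add[OF _ I_uminus] by fastforce

lemma I_mult: "f \<in> I m \<Longrightarrow> g \<in> I n \<Longrightarrow> f * g \<in> I (m + n)"
  by (auto simp: I_def image_iff power_add intro!: bexI[OF _ mult_in])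

lemma I_mult_left: "f \<in> R \<Longrightarrow> g \<in> I n \<Longrightarrow> f * g \<in> I n"
  using I_mult[of f 0 g n] by simp

lemma I_Suc_subset: "I (Suc n) \<subseteq> I n"
  by (auto simp: I_def image_iff mult.assoc intro!: bexI[OF _ mult_in[OF t_in]])

lemma I_antimono: "m \<le> n \<Longrightarrow> I n \<subseteq> I m"
  by (rule lift_Suc_antimono_le) (rule I_Suc_subset)

lemma I_mono_mem: "f \<in> I n \<Longrightarrow> m \<le> n \<Longrightarrow> f \<in> I m"
  using I_antimono by blast

lemma of_nat_in: "of_nat n \<in> R"
  by (induction n) (auto intro: zero_in one_in add_in)

lemma of_int_in: "of_int n \<in> R"
  by (cases n) (auto intro!: uminus_in simp: of_nat_in simp del: of_nat_Suc)

lemma numeral_in: "numeral n \<in> R"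
  using of_nat_in[of "numeral n"] by simp

lemma I_of_int_cancel: "of_int n * f \<in> I k \<Longrightarrow> n \<noteq> 0 \<Longrightarrow> f \<in> I k"
  using I_mult_left[OF inverse_int[of n], of "of_int n * f" k] by (simp flip: mult.assoc)

lemma unit_I:
  assumes "u - 1 \<in> I 1"
  shows "u \<noteq> 0" "inverse u \<in> R"
proof -
  obtain f where "f \<in> R" "u - 1 = t * f"
    using assms by (auto simp: I_def)
  then have "u = 1 + t * f"
    by (simp add: algebra_simps)
  with inverse_unit[OF \<open>f \<in> R\<close>] show "u \<noteq> 0" "inverse u \<in> R"
    by simp_all
qed

lemma I_divide_unit: "u - 1 \<in> I 1 \<Longrightarrow> f \<in> I n \<Longrightarrow> f / u \<in> I n"
  using I_mult_left[OF unit_I(2)] by (simp add: divide_inverse mult.commute)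

section \<open>The kernel of reduction and its parameter\<close>

fun zcoord :: "'a ecpoint \<Rightarrow> 'a" where
  "zcoord Infinity = 0"
| "zcoord (Point x y) = x / y"

text \<open>In the chart z = x / y, w = 1 / y around infinity these are the points reducing to the
  origin; the order 3 of w reflects w = z^3 + ... on the curve.\<close>

fun in_kernel :: "'a ecpoint \<Rightarrow> bool" where
  "in_kernel Infinity = True"
| "in_kernel (Point x y) = (y \<noteq> 0 \<and> x / y \<in> I 1 \<and> 1 / y \<in> I 3)"

lemma I_mult_le: "f \<in> I m \<Longrightarrow> g \<in> I n \<Longrightarrow> k \<le> m + n \<Longrightarrow> f * g \<in> I k"
  by (rule I_mono_mem[OF I_mult])

text \<open>The line \<open>y = l x + m\<close> reads \<open>1 / y = 1 / m - (l / m) (x / y)\<close> in the chart at infinity.\<close>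
lemma line_in_kernel:
  assumes a_in: "a2 \<in> R" "a4 \<in> R" "a6 \<in> R"
    and c1: "y1^2 = x1^3 + a2 * x1^2 + a4 * x1 + a6"
    and c2: "y2^2 = x2^3 + a2 * x2^2 + a4 * x2 + a6"
    and k1: "in_kernel (Point x1 y1)" and k2: "in_kernel (Point x2 y2)"
    and nv: "\<not> (x1 = x2 \<and> y1 = - y2)"
    and l: "l = (if x1 = x2 then (3 * x1^2 + 2 * a2 * x1 + a4) / (2 * y1) else (y2 - y1) / (x2 - x1))"
    and m: "m = y1 - l * x1"
  shows "m \<noteq> 0" "l / m \<in> I 2" "1 / m \<in> I 3"
proof -
  define z1 w1 z2 w2 where "z1 = x1 / y1" and "w1 = 1 / y1" and "z2 = x2 / y2" and "w2 = 1 / y2"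
  note zw = z1_def w1_def z2_def w2_def
  have nz: "y1 \<noteq> 0" "y2 \<noteq> 0" and z: "z1 \<in> I 1" "z2 \<in> I 1" and w: "w1 \<in> I 3" "w2 \<in> I 3"
    using k1 k2 by (auto simp: zw)
  have wnz: "w1 \<noteq> 0" "w2 \<noteq> 0"
    using nz by (auto simp: zw)
  have xz: "x1 = z1 * y1" "x2 = z2 * y2" "w1 * y1 = 1" "w2 * y2 = 1"
    using nz by (auto simp: zw)
  \<comment> \<open>The curve equation divided by the cube of y.\<close>
  have ch1: "w1 = z1^3 + a2 * z1^2 * w1 + a4 * z1 * w1^2 + a6 * w1^3"
    using c1 xz by algebra
  have ch2: "w2 = z2^3 + a2 * z2^2 * w2 + a4 * z2 * w2^2 + a6 * w2^3"
    using c2 xz by algebra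
  txt \<open>In the chart \<open>(z, w)\<close> the line has slope \<open>- l / m\<close>; it equals \<open>N / D\<close> both for chords and
    for tangents, and \<open>D\<close> is a unit.\<close>
  define D where "D = 1 - a2 * z1 * z1 - a4 * z1 * (w1 + w2) - a6 * (w1 * w1 + w1 * w2 + w2 * w2)"
  define N where "N = z1 * z1 + z1 * z2 + z2 * z2 + a2 * (z1 + z2) * w2 + a4 * w2 * w2"
  have inR: "z1 \<in> R" "z2 \<in> R" "w1 \<in> R" "w2 \<in> R"
    using I_mono_mem[of _ _ 0] z w by auto
  have in1: "w1 \<in> I 1" "w2 \<in> I 1" and in2: "w1 \<in> I 2" "w2 \<in> I 2"
    using I_mono_mem[of _ 3] w by auto
  have zz: "z1 * z1 \<in> I 2" "z1 * z2 \<in> I 2" "z2 * z2 \<in> I 2"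
    using z by (auto intro: I_mult_le)
  have "D - 1 = - (a2 * z1 * z1 + a4 * z1 * (w1 + w2) + a6 * (w1 * w1 + w1 * w2 + w2 * w2))"
    by (simp add: D_def)
  also have "\<dots> \<in> I 1"
    using a_in inR z in1 by (intro I_uminus I_add I_mult_left mult_in)
  finally have D: "D - 1 \<in> I 1" .
  have N: "N \<in> I 2"
    unfolding N_def using a_in inR zz in2 by (auto intro!: I_add zz intro: I_mult_left mult_in add_in)
  note D0 = unit_I(1)[OF D]
  have mw1: "m * w1 = 1 - l * z1"
    using m xz by algebra
  have key: "m \<noteq> 0 \<and> l * D = - (m * N)"
  proof (cases "x1 = x2")
    case True
    have "(y1 - y2) * (y1 + y2) = 0"
      using c1 c2 True by algebra
    with nv True have eq: "y1 = y2"
      by (auto simp: add_eq_0_iff)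
    have zw12: "z2 = z1" "w2 = w1"
      using True eq by (auto simp: zw)
    have "l * (2 * y1) = 3 * x1^2 + 2 * a2 * x1 + a4"
      using nz True by (simp add: l)
    then have lw: "2 * w1 * l = N"
      unfolding N_def zw12 using xz by algebra
    \<comment> \<open>\<open>N\<close> and \<open>- D\<close> are here the partial derivatives of
      the chart equation. The relation D = - 2 w1 m gives both claims: \<open>m\<close> is nonzero
      since the unit \<open>D\<close> is, and multiplying by \<open>l\<close> turns 2 w1 l into
      \<open>N\<close>.\<close>
    have "w1 * (2 * w1 * m + D) = 0"
      unfolding D_def zw12 using lw[unfolded N_def zw12] mw1 ch1 by algebra
    then have "2 * w1 * m + D = 0"
      using wnz by simp
    then show ?thesis
      using lw D0 by (auto, algebra)
  next
    case False
    have "l * (x2 - x1) = y2 - y1"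
      using False by (simp add: l)
    then have mw2: "m * w2 = 1 - l * z2"
      using m xz by algebra
    \<comment> \<open>Subtract the chart equations, splitting each mixed difference into multiples
      of \<open>w1 - w2\<close> and \<open>z1 - z2\<close>.\<close>
    have dw: "(w1 - w2) * D = (z1 - z2) * N"
      unfolding D_def N_def using ch1 ch2 by algebra
    have zne: "z1 \<noteq> z2"
    proof
      assume "z1 = z2"
      with dw D0 have "w1 = w2" by simp
      with \<open>z1 = z2\<close> nz have "x1 = x2" by (simp add: zw)
      with False show False by simp
    qed
    \<comment> \<open>A line with m = 0 has constant z = 1 / l, against \<open>zne\<close>.\<close>
    moreover have "m \<noteq> 0"
    proof
      assume "m = 0"
      with mw1 mw2 have "l * z1 = 1" "l * z2 = 1" by auto
      then have "z1 = z2" by algebra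
      with zne show False by simp
    qed
    moreover have "(z1 - z2) * (l * D + m * N) = 0"
      using dw mw1 mw2 by algebra
    ultimately show ?thesis
      by (simp add: add_eq_0_iff)
  qed
  then show m0: "m \<noteq> 0" by simp
  have "l / m = - (N / D)"
    using key D0 by (simp add: field_simps)
  also have "\<dots> \<in> I 2"
    by (intro I_uminus I_divide_unit D N)
  finally show lm: "l / m \<in> I 2" .
  have "1 / m = w1 + l / m * z1"
    using mw1 m0 by (simp add: field_simps)
  also have "\<dots> \<in> I 3"
    using w lm z by (intro I_add I_mult_le[of _ 2 _ 1]) auto
  finally show "1 / m \<in> I 3" .
qed

definition in_kernel_on :: "'a \<Rightarrow> 'a \<Rightarrow> 'a \<Rightarrow> 'a ecpoint \<Rightarrow> bool" where
  "in_kernel_on a2 a4 a6 P \<longleftrightarrow> on_curve a2 a4 a6 P \<and> in_kernel P"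

text \<open>With the third intersection point, the three parameters add up to V / (m U), where
  \<open>V\<close> lies in R, \<open>U\<close> is a unit and 1 / m has order at least 3. Reflecting
  the third point changes the sign of its parameter.\<close>

lemma kernel_add_Point:
  assumes a_in: "a2 \<in> R" "a4 \<in> R" "a6 \<in> R"
    and c1: "y1^2 = x1^3 + a2 * x1^2 + a4 * x1 + a6"
    and c2: "y2^2 = x2^3 + a2 * x2^2 + a4 * x2 + a6"
    and k1: "in_kernel (Point x1 y1)" and k2: "in_kernel (Point x2 y2)"
    and nv: "\<not> (x1 = x2 \<and> y1 = - y2)"
  defines "S \<equiv> ec_add a2 a4 a6 (Point x1 y1) (Point x2 y2)"
  shows "in_kernel_on a2 a4 a6 S" "zcoord S - (x1 / y1 + x2 / y2) \<in> I 3"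
proof -
  define l where l: "l = (if x1 = x2 then (3 * x1^2 + 2 * a2 * x1 + a4) / (2 * y1)
    else (y2 - y1) / (x2 - x1))"
  define m where m: "m = y1 - l * x1"
  define x3 where x3: "x3 = l^2 - a2 - x1 - x2"
  define y3 where y3: "y3 = l * x3 + m"
  have S: "S = Point x3 (- y3)"
    unfolding S_def using nv by (auto simp: l x3 y3 m Let_def algebra_simps)
  note line = line_in_kernel[OF a_in c1 c2 k1 k2 nv l m]
  have nz: "y1 \<noteq> 0" "y2 \<noteq> 0"
    using k1 k2 by auto
  have y1: "y1 = l * x1 + m"
    by (simp add: m)
  have vieta: "y2 = l * x2 + m \<and> x1 * x2 + x1 * x3 + x2 * x3 = a4 - 2 * l * m
    \<and> x1 * x2 * x3 = m^2 - a6"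
  proof (cases "x1 = x2")
    case True
    have "(y1 - y2) * (y1 + y2) = 0"
      using c1 c2 True by algebra
    with nv True have eq: "y1 = y2"
      by (auto simp: add_eq_0_iff)
    have "l = (3 * x1^2 + 2 * a2 * x1 + a4) / (2 * y1)" "x3 = l^2 - a2 - x1 - x1"
      using True by (simp_all add: l x3)
    from tangent_vieta[OF _ nz(1) c1 this(1) m this(2)] show ?thesis
      using True eq y1 by simp
  next
    case False
    then have "l = (y2 - y1) / (x2 - x1)"
      by (simp add: l)
    from chord_vieta[OF False c1 c2 this m x3] show ?thesis
      by simp
  qed
  note y2 = vieta[THEN conjunct1] and e2 = vieta[THEN conjunct2, THEN conjunct1]
    and e3 = vieta[THEN conjunct2, THEN conjunct2]
  note prods = collinear_products[OF x3 e2 e3 y1 y2 y3]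
  define \<kappa> where "\<kappa> = l / m"
  define \<nu> where "\<nu> = 1 / m"
  have \<kappa>: "\<kappa> \<in> I 2" and \<nu>: "\<nu> \<in> I 3" and m0: "m \<noteq> 0"
    using line by (auto simp: \<kappa>_def \<nu>_def)
  have \<kappa>R: "\<kappa> \<in> R" and \<kappa>1: "\<kappa> \<in> I 1"
    using I_mono_mem[OF \<kappa>, of 0] I_mono_mem[OF \<kappa>, of 1] by auto
  have lm: "l = \<kappa> * m" "\<nu> * m = 1"
    using m0 by (auto simp: \<kappa>_def \<nu>_def)
  \<comment> \<open>\<open>U\<close> and \<open>V\<close> are the forms of
    \<open>collinear_products\<close> divided by m^3 and m^2, with l = \<kappa> m.\<close>
  define U where "U = 1 - a2 * \<kappa> + a4 * \<kappa> * \<kappa> - a6 * \<kappa> * \<kappa> * \<kappa>"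
  define V where "V = 2 * a4 * \<kappa> - 3 * a6 * \<kappa> * \<kappa> - a2"
  have "U - 1 = a4 * \<kappa> * \<kappa> - a2 * \<kappa> - a6 * \<kappa> * \<kappa> * \<kappa>"
    by (simp add: U_def)
  also have "\<dots> \<in> I 1"
    using a_in \<kappa>R \<kappa>1 by (intro I_diff I_mult_left mult_in)
  finally have U: "U - 1 \<in> I 1" .
  note U0 = unit_I(1)[OF U]
  have "2 * a4 * \<kappa> - 3 * a6 * \<kappa> * \<kappa> - a2 \<in> I 0"
    using a_in \<kappa>R by (intro I_diff) (auto intro!: mult_in numeral_in)
  then have V: "V \<in> R"
    by (simp add: V_def)
  have yyy: "y1 * y2 * y3 = m^3 * U"
    unfolding prods(1) U_def lm(1) by algebra
  then have y3nz: "y3 \<noteq> 0"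
    using m0 U0 by auto
  have "x1 / y1 + x2 / y2 + x3 / y3 = (x1 * y2 * y3 + x2 * y1 * y3 + x3 * y1 * y2) / (y1 * y2 * y3)"
    using nz y3nz by (simp add: field_simps)
  also have "\<dots> = m^2 * V / (m^3 * U)"
    unfolding prods(2) yyy by (simp add: V_def lm(1) algebra_simps power2_eq_square)
  also have "\<dots> = V * \<nu> / U"
    using m0 by (simp add: \<nu>_def power2_eq_square power3_eq_cube)
  also have "\<dots> \<in> I 3"
    by (intro I_divide_unit U I_mult_left V \<nu>)
  finally have sum: "x1 / y1 + x2 / y2 + x3 / y3 \<in> I 3" .
  have "zcoord S - (x1 / y1 + x2 / y2) = - (x1 / y1 + x2 / y2 + x3 / y3)"
    by (simp add: S)
  with I_uminus[OF sum] show "zcoord S - (x1 / y1 + x2 / y2) \<in> I 3"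
    by (simp only:)
  have "x3 / y3 = (x1 / y1 + x2 / y2 + x3 / y3) - x1 / y1 - x2 / y2"
    by simp
  also have "\<dots> \<in> I 1"
    using k1 k2 by (intro I_diff I_mono_mem[OF sum]) auto
  finally have z1: "x3 / y3 \<in> I 1" .
  \<comment> \<open>The line equation divided by \<open>m\<close>; dividing again by
    \<open>y3\<close> bounds the order of 1 / y3.\<close>
  have "\<nu> * y3 = \<kappa> * x3 + 1"
    using lm y3 by algebra
  then have "1 / y3 = \<nu> - \<kappa> * (x3 / y3)"
    using y3nz by (simp add: field_simps)
  also have "\<dots> \<in> I 3"
    by (intro I_diff \<nu> I_mult_le[OF \<kappa> z1]) simp
  finally have "1 / y3 \<in> I 3" .
  with z1 have "in_kernel S"
    using I_uminus y3nz by (force simp: S)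
  moreover have "on_curve a2 a4 a6 S"
    using third_intersection_on_curve[OF x3 e2 e3, folded y3] by (simp add: S on_curve_def)
  ultimately show "in_kernel_on a2 a4 a6 S"
    by (simp add: in_kernel_on_def)
qed

text \<open>The remaining cases are exact: infinity has parameter 0, and opposite points have
  opposite parameters.\<close>

lemma kernel_add:
  assumes a_in: "a2 \<in> R" "a4 \<in> R" "a6 \<in> R"
    and "in_kernel_on a2 a4 a6 P" "in_kernel_on a2 a4 a6 Q"
  shows "in_kernel_on a2 a4 a6 (ec_add a2 a4 a6 P Q) \<and>
    zcoord (ec_add a2 a4 a6 P Q) - (zcoord P + zcoord Q) \<in> I 3"
proof (cases P)
  case Infinity
  then show ?thesis using assms by (simp add: I_zero)
next
  case P: (Point x1 y1)
  show ?thesis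
  proof (cases Q)
    case Infinity
    then show ?thesis using assms by (simp add: I_zero)
  next
    case Q: (Point x2 y2)
    show ?thesis
    proof (cases "x1 = x2 \<and> y1 = - y2")
      case True
      then show ?thesis by (simp add: P Q I_zero in_kernel_on_def on_curve_def)
    next
      case False
      then show ?thesis
        using kernel_add_Point[OF a_in _ _ _ _ False] assms(4,5)
        by (simp add: P Q in_kernel_on_def on_curve_def)
    qed
  qed
qed

lemma kernel_nmul:
  assumes a_in: "a2 \<in> R" "a4 \<in> R" "a6 \<in> R" and P: "in_kernel_on a2 a4 a6 P"
  shows "in_kernel_on a2 a4 a6 (ec_nmul a2 a4 a6 n P) \<and>
    zcoord (ec_nmul a2 a4 a6 n P) - of_nat n * zcoord P \<in> I 3"
proof (induction n)
  case 0
  show ?case by (simp add: I_zero in_kernel_on_def on_curve_def)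
next
  case (Suc n)
  let ?Q = "ec_nmul a2 a4 a6 n P"
  have "in_kernel_on a2 a4 a6 (ec_nmul a2 a4 a6 (Suc n) P)"
    and "zcoord (ec_nmul a2 a4 a6 (Suc n) P) - (zcoord P + zcoord ?Q) \<in> I 3"
    using kernel_add[OF a_in P] Suc by auto
  then show ?case
    using I_add[of "zcoord (ec_nmul a2 a4 a6 (Suc n) P) - (zcoord P + zcoord ?Q)" 3
        "zcoord ?Q - of_nat n * zcoord P"] Suc
    by (simp add: algebra_simps)
qed

lemma kernel_neg:
  assumes "in_kernel_on a2 a4 a6 P"
  shows "in_kernel_on a2 a4 a6 (ec_neg P)" "zcoord (ec_neg P) = - zcoord P"
  using assms I_uminus by (cases P; force simp: in_kernel_on_def on_curve_def)+

lemma kernel_mul: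
  assumes "a2 \<in> R" "a4 \<in> R" "a6 \<in> R" and "in_kernel_on a2 a4 a6 P"
  shows "in_kernel_on a2 a4 a6 (ec_mul a2 a4 a6 n P) \<and>
    zcoord (ec_mul a2 a4 a6 n P) - of_int n * zcoord P \<in> I 3"
proof (cases "n \<ge> 0")
  case True
  then show ?thesis
    using kernel_nmul[OF assms, of "nat n"] by (simp add: ec_mul_def)
next
  case False
  let ?Q = "ec_nmul a2 a4 a6 (nat (- n)) P"
  have "in_kernel_on a2 a4 a6 ?Q" and z: "zcoord ?Q - of_nat (nat (- n)) * zcoord P \<in> I 3"
    using kernel_nmul[OF assms] by auto
  then show ?thesis
    using False I_uminus[OF z] kernel_neg[of a2 a4 a6 ?Q] by (simp add: ec_mul_def)
qed

text \<open>A relation m P + n Q = 0 becomes m z(P) + n z(Q) in \<open>I 3\<close>. Modulo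
  \<open>I 2\<close> the second term drops out, and integers cancel as units, so m = 0; what remains
  forces n = 0.\<close>

lemma kernel_independent:
  assumes a_in: "a2 \<in> R" "a4 \<in> R" "a6 \<in> R"
    and P: "in_kernel_on a2 a4 a6 P" and Q: "in_kernel_on a2 a4 a6 Q"
    and "zcoord P \<notin> I 2" "zcoord Q \<in> I 2" "zcoord Q \<notin> I 3"
  shows "ec_independent a2 a4 a6 [P, Q]"
proof -
  have "m = 0 \<and> n = 0"
    if inf: "ec_add a2 a4 a6 (ec_mul a2 a4 a6 m P) (ec_mul a2 a4 a6 n Q) = Infinity" for m n
  proof -
    let ?P = "ec_mul a2 a4 a6 m P" and ?Q = "ec_mul a2 a4 a6 n Q"
    have mP: "in_kernel_on a2 a4 a6 ?P" "zcoord ?P - of_int m * zcoord P \<in> I 3"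
      and nQ: "in_kernel_on a2 a4 a6 ?Q" "zcoord ?Q - of_int n * zcoord Q \<in> I 3"
      using kernel_mul[OF a_in] P Q by auto
    have "- (zcoord ?P + zcoord ?Q) \<in> I 3"
      using kernel_add[OF a_in mP(1) nQ(1)] inf by simp
    from I_uminus[OF I_add[OF I_add[OF this mP(2)] nQ(2)]]
    have rel: "of_int m * zcoord P + of_int n * zcoord Q \<in> I 3"
      by (simp add: algebra_simps)
    have "of_int m * zcoord P + of_int n * zcoord Q - of_int n * zcoord Q \<in> I 2"
      by (rule I_diff[OF I_mono_mem[OF rel] I_mult_left[OF of_int_in]]) (use assms in simp_all)
    then have m: "m = 0"
      using I_of_int_cancel[of m "zcoord P" 2] assms by auto
    with rel have "n = 0"
      using I_of_int_cancel[of n "zcoord Q" 3] assms by auto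
    with m show ?thesis by simp
  qed
  then show ?thesis
    by (auto simp: ec_independent_def ec_lincomb_def length_Suc_conv)
qed

lemma unit_not_in_I:
  assumes "u \<in> R" "inverse u \<in> R" "u \<noteq> 0"
  shows "t^n * u \<in> I n" "t^n * u \<notin> I (Suc n)"
proof -
  show "t^n * u \<in> I n"
    using assms(1) by (auto simp: I_def)
  show "t^n * u \<notin> I (Suc n)"
  proof
    assume "t^n * u \<in> I (Suc n)"
    then obtain f where "f \<in> R" "t^n * u = t^n * (t * f)"
      by (auto simp: I_def ac_simps)
    then have "u = t * f" using t_nonzero by simp
    \<comment> \<open>A unit divisible by \<open>t\<close> would make an element congruent to 1
      vanish.\<close>
    then have "1 + t * - (f * inverse u) = 0"
      using assms(3) by (simp add: field_simps)
    then show False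
      using inverse_unit[OF uminus_in[OF mult_in[OF \<open>f \<in> R\<close> assms(2)]]] by simp
  qed
qed

text \<open>Poles of exact order 2n in x and 3n in y make the parameter \<open>t^n\<close> times the
  unit X / Y.\<close>

lemma scaled_point_in_kernel:
  assumes "X \<in> R" "inverse X \<in> R" "X \<noteq> 0" "Y \<in> R" "inverse Y \<in> R" "Y \<noteq> 0" "n \<ge> 1"
  defines "P \<equiv> Point (X / (t^n)^2) (Y / (t^n)^3)"
  shows "in_kernel P" "zcoord P \<in> I n" "zcoord P \<notin> I (Suc n)"
proof -
  have z: "X / (t^n)^2 / (Y / (t^n)^3) = t^n * (X * inverse Y)"
    using t_nonzero assms(6) by (simp add: field_simps power2_eq_square power3_eq_cube)
  have u: "X * inverse Y \<in> R" "inverse (X * inverse Y) \<in> R" "X * inverse Y \<noteq> 0"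
    using assms by (simp_all add: mult_in)
  from unit_not_in_I[OF this]
  show zn: "zcoord P \<in> I n" and "zcoord P \<notin> I (Suc n)"
    unfolding P_def zcoord.simps z .
  have "1 / (Y / (t^n)^3) = t^(n * 3) * inverse Y"
    by (simp add: divide_inverse power_mult)
  also have "\<dots> \<in> I (n * 3)"
    using assms(5) by (auto simp: I_def)
  finally have "1 / (Y / (t^n)^3) \<in> I 3"
    by (rule I_mono_mem) (use \<open>n \<ge> 1\<close> in simp)
  then show "in_kernel P"
    using I_mono_mem[OF zn \<open>n \<ge> 1\<close>] t_nonzero assms(6) by (simp add: P_def)
qed

end

section \<open>The local ring of rational functions at k = c\<close>

definition regular_at :: "rat \<Rightarrow> ratfun set" where
  "regular_at c = {Fract p q | p q. poly q c \<noteq> 0}"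

lemma regular_at_local_subring: "local_subring (regular_at c) (Fract [:- c, 1:] 1)"
proof
  show "1 \<in> regular_at c"
    by (auto simp: regular_at_def One_fract_def intro!: exI[of _ 1])
  show "Fract [:- c, 1:] 1 \<in> regular_at c"
    unfolding regular_at_def by (force intro: exI[of _ 1])
  show "Fract [:- c, 1:] 1 \<noteq> (0::ratfun)"
    by (simp add: Zero_fract_def eq_fract)
next
  fix f g assume "f \<in> regular_at c" "g \<in> regular_at c"
  then obtain p q r s where f: "f = Fract p q" "poly q c \<noteq> 0" and g: "g = Fract r s" "poly s c \<noteq> 0"
    by (auto simp: regular_at_def)
  have nz: "q \<noteq> 0" "s \<noteq> 0"
    using f g by auto
  have "f + g = Fract (p * s + r * q) (q * s)"
    using nz by (simp add: f g)
  then show "f + g \<in> regular_at c"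
    using f g unfolding regular_at_def by force
  have "f * g = Fract (p * r) (q * s)"
    by (simp add: f g)
  then show "f * g \<in> regular_at c"
    using f g unfolding regular_at_def by force
next
  fix f assume "f \<in> regular_at c"
  then obtain p q where f: "f = Fract p q" "poly q c \<noteq> 0"
    by (auto simp: regular_at_def)
  have q: "q \<noteq> 0"
    using f by auto
  have "- f = Fract (- p) q"
    by (simp add: f)
  then show "- f \<in> regular_at c"
    using f unfolding regular_at_def by blast
  \<comment> \<open>\<open>?u\<close> agrees with \<open>q\<close> at \<open>c\<close>, so q / ?u is
    again regular there.\<close>
  let ?u = "q + [:- c, 1:] * p"
  have u: "poly ?u c \<noteq> 0"
    using f by simp
  then have "?u \<noteq> 0"
    by (metis poly_0)
  moreover have eq: "1 + Fract [:- c, 1:] 1 * f = Fract ?u q"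
    using q by (simp add: f One_fract_def)
  ultimately show "1 + Fract [:- c, 1:] 1 * f \<noteq> 0 \<and> inverse (1 + Fract [:- c, 1:] 1 * f) \<in> regular_at c"
    using q u unfolding eq inverse_fract regular_at_def mem_Collect_eq
    by (intro conjI exI[of _ q] exI[of _ ?u]) (simp_all add: Zero_fract_def eq_fract)
next
  fix n :: int
  have of_int: "(of_int n :: ratfun) = Fract (of_int n) 1" for n
    by (cases n) (simp_all add: of_nat_fract One_fract_def)
  show "inverse (of_int n) \<in> regular_at c"
  proof (cases "n = 0")
    case True
    then have "inverse (of_int n) = Fract 0 (1 :: rat poly)"
      by (simp flip: Zero_fract_def)
    then show ?thesis
      unfolding regular_at_def by force
  next
    case False
    then have "poly (of_int n) c \<noteq> 0" by simp
    then show ?thesis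
      unfolding of_int inverse_fract regular_at_def by blast
  qed
qed

section \<open>Reduction to polynomial identities and values\<close>

text \<open>Handles the three linear factors separately, so that checking a point never expands the
  full cubic.\<close>

lemma on_curve_scaled:
  fixes s :: "'a::field"
  assumes "s \<noteq> 0" "X + p * s^2 = f" "X + q * s^2 = g" "X + r * s^2 = h" "Y^2 = f * g * h"
  shows "on_curve (p + q + r) (p * q + q * r + r * p) (p * q * r) (Point (X / s^2) (Y / s^3))"
proof -
  have "X / s^2 + p = f / s^2" "X / s^2 + q = g / s^2" "X / s^2 + r = h / s^2"
    using assms(1) by (simp_all add: field_simps flip: assms(2-4))
  then have "(X / s^2 + p) * (X / s^2 + q) * (X / s^2 + r) = f / s^2 * (g / s^2) * (h / s^2)"
    by simp
  also have "\<dots> = f * g * h / (s^3)^2"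
    using assms(1) by (simp add: field_simps flip: power_add power_mult)
  also have "\<dots> = (Y / s^3)^2"
    by (simp add: assms(5) power_divide)
  finally show ?thesis
    unfolding on_curve_def ecpoint.case by algebra
qed

text \<open>Turns expressions in \<open>kvar\<close> into polynomials, which can be evaluated at a
  point.\<close>

lemma Fract_1_hom:
  "Fract (p + q) 1 = Fract p 1 + Fract q (1::'a::idom)"
  "Fract (p - q) 1 = Fract p 1 - Fract q (1::'a)"
  "Fract (p * q) 1 = Fract p 1 * Fract q (1::'a)"
  "Fract (- p) 1 = - Fract p (1::'a)"
  "Fract (p ^ n) 1 = Fract p (1::'a) ^ n"
  "Fract (numeral m) (1::'a) = numeral m"
proof -
  show "Fract (p ^ n) 1 = Fract p (1::'a) ^ n"
    by (induction n) (simp add: One_fract_def, metis mult_fract mult_1 power_Suc)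
  show "Fract (numeral m) (1::'a) = numeral m"
    using Fract_of_nat_eq[of "numeral m"] by simp
qed simp_all

lemma Fract_1_unit:
  assumes "poly p c \<noteq> 0"
  shows "Fract p 1 \<in> regular_at c" "inverse (Fract p 1) \<in> regular_at c" "Fract p 1 \<noteq> 0"
proof -
  have "p \<noteq> 0" using assms by auto
  then show "Fract p 1 \<noteq> 0"
    by (simp add: Zero_fract_def eq_fract)
  show "inverse (Fract p 1) \<in> regular_at c"
    using assms by (auto simp: regular_at_def)
  show "Fract p 1 \<in> regular_at c"
    unfolding regular_at_def by force
qed

section \<open>The two explicit points\<close>

theorem theorem4p2:
  fixes a b c :: ratfun
  assumes "a = 10 * kvar^2 - 8 * kvar + 8"
      and "b = kvar * (kvar^2 - 4 * kvar + 20)"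
      and "c = (kvar + 2) * (kvar^2 - 4)"
  shows "ec_rank_at_least_roots (a * b) (b * c) (a * c) 2"
proof -
  \<comment> \<open>At k = 2 one has a = b = 32 and c = 0, so the cubic reduces to x^2 (x + 1024),
    with a node. The kernel argument applies because the coefficients are regular there.\<close>
  define t where "t = kvar - 2"
  have t: "t = Fract [:- 2, 1:] 1"
    unfolding t_def kvar_def Fract_1_hom(6)[symmetric] Fract_1_hom(2)[symmetric]
    by (simp add: numeral_poly)
  interpret local_subring "regular_at 2" t
    unfolding t by (rule regular_at_local_subring)
  have int: "Fract p 1 \<in> regular_at 2" for p
    unfolding regular_at_def by force
  \<comment> \<open>\<open>e\<close> is b / k. For both points the cleared factors x + ab and x + bc
    share \<open>v\<close>, while x + bc and x + ac share \<open>u\<close>; this makes the product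
    of the three a square.\<close>
  define u v e where "u = kvar^2 - 12 * kvar + 4" and "v = kvar^3 - 8 * kvar^2 + 4 * kvar - 16"
    and "e = kvar^2 - 4 * kvar + 20"
  define X1 Y1 where "X1 = kvar * (kvar + 2)^3 * a * (6 - kvar)"
    and "Y1 = - 4 * kvar * (kvar + 2)^2 * a * u * v"
  define X2 Y2 where "X2 = kvar * (kvar + 2)^2 * e * (- 32 + 128 * kvar - 16 * kvar^2 + 64 * kvar^3 - 10 * kvar^4)"
    and "Y2 = - 16 * kvar^2 * (kvar + 2)^4 * e * u * v"
  note defs = assms u_def v_def e_def t_def X1_def Y1_def X2_def Y2_def
  let ?k = "[:0, 1:] :: rat poly"
  let ?a = "10 * ?k^2 - 8 * ?k + 8" and ?u = "?k^2 - 12 * ?k + 4"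
    and ?v = "?k^3 - 8 * ?k^2 + 4 * ?k - 16" and ?e = "?k^2 - 4 * ?k + 20"
  have polys: "a = Fract ?a 1" "b = Fract (?k * ?e) 1" "c = Fract ((?k + 2) * (?k^2 - 4)) 1"
    "X1 = Fract (?k * (?k + 2)^3 * ?a * (6 - ?k)) 1"
    "Y1 = Fract (- 4 * ?k * (?k + 2)^2 * ?a * ?u * ?v) 1"
    "X2 = Fract (?k * (?k + 2)^2 * ?e * (- 32 + 128 * ?k - 16 * ?k^2 + 64 * ?k^3 - 10 * ?k^4)) 1"
    "Y2 = Fract (- 16 * ?k^2 * (?k + 2)^4 * ?e * ?u * ?v) 1"
    by (simp_all only: defs kvar_def Fract_1_hom)
  have R: "a \<in> regular_at 2" "b \<in> regular_at 2" "c \<in> regular_at 2"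
    unfolding polys by (rule int)+
  \<comment> \<open>At k = 2 no factor vanishes: u = -16, v = -32, e = 16, and the quartic in
    \<open>X2\<close> is 512. Hence the powers of \<open>t\<close> in the denominators below are the
    exact pole orders.\<close>
  have X1: "X1 \<in> regular_at 2" "inverse X1 \<in> regular_at 2" "X1 \<noteq> 0"
    and Y1: "Y1 \<in> regular_at 2" "inverse Y1 \<in> regular_at 2" "Y1 \<noteq> 0"
    and X2: "X2 \<in> regular_at 2" "inverse X2 \<in> regular_at 2" "X2 \<noteq> 0"
    and Y2: "Y2 \<in> regular_at 2" "inverse Y2 \<in> regular_at 2" "Y2 \<noteq> 0"
    unfolding polys by (rule Fract_1_unit[where c = 2], simp)+
  txt \<open>\<open>P = P\<^sub>0 + Q\<^sub>0 + T\<close> and \<open>Q = 2 P\<^sub>0 + T\<close>, up to sign.\<close>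
  define P Q where "P = Point (X1 / (t^1)^2) (Y1 / (t^1)^3)" and "Q = Point (X2 / (t^2)^2) (Y2 / (t^2)^3)"
  let ?a2 = "a * b + b * c + a * c" and ?a4 = "a * b * (b * c) + b * c * (a * c) + a * c * (a * b)"
    and ?a6 = "a * b * (b * c) * (a * c)"
  have P: "on_curve ?a2 ?a4 ?a6 P"
    unfolding P_def
  proof (rule on_curve_scaled)
    show "X1 + a * b * (t^1)^2 = - 8 * kvar * a * v"
      unfolding defs by algebra
    show "X1 + b * c * (t^1)^2 = kvar * (kvar + 2)^2 * u * v"
      unfolding defs by algebra
    show "X1 + a * c * (t^1)^2 = - 2 * (kvar + 2)^2 * a * u"
      unfolding defs by algebra
    show "Y1^2 = - 8 * kvar * a * v * (kvar * (kvar + 2)^2 * u * v) * (- 2 * (kvar + 2)^2 * a * u)"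
      unfolding Y1_def by algebra
  qed (use t_nonzero in simp)
  have Q: "on_curve ?a2 ?a4 ?a6 Q"
    unfolding Q_def
  proof (rule on_curve_scaled)
    show "X2 + a * b * (t^2)^2 = - 64 * kvar^3 * e * v"
      unfolding defs by algebra
    show "X2 + b * c * (t^2)^2 = kvar * (kvar + 2)^2 * e * u * v"
      unfolding defs by algebra
    show "X2 + a * c * (t^2)^2 = - 4 * (kvar + 2)^6 * u"
      unfolding defs by algebra
    show "Y2^2 = - 64 * kvar^3 * e * v * (kvar * (kvar + 2)^2 * e * u * v) * (- 4 * (kvar + 2)^6 * u)"
      unfolding Y2_def by algebra
  qed (use t_nonzero in simp)
  \<comment> \<open>\<open>order_refl\<close> selects n = 1, and the numeral
    \<open>Num.Bit0 Num.One\<close> selects n = 2; the \<open>t^1\<close> in \<open>P_def\<close>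
    makes the folding match.\<close>
  note kP = scaled_point_in_kernel[OF X1 Y1 order_refl, folded P_def]
  note kQ = scaled_point_in_kernel[OF X2 Y2 one_le_numeral, of "Num.Bit0 Num.One", folded Q_def]
  have "ec_independent ?a2 ?a4 ?a6 [P, Q]"
  proof (rule kernel_independent)
    show "?a2 \<in> regular_at 2" "?a4 \<in> regular_at 2" "?a6 \<in> regular_at 2"
      by (intro add_in mult_in R)+
    show "zcoord P \<notin> I 2" "zcoord Q \<in> I 2" "zcoord Q \<notin> I 3"
      using kP(3) kQ(2,3) by (simp_all add: eval_nat_numeral del: zcoord.simps)
  qed (use P Q kP(1) kQ(1) in \<open>auto simp only: in_kernel_on_def\<close>)
  then show ?thesis
    unfolding ec_rank_at_least_roots_def ec_rank_at_least_def
    using P Q by (intro exI[of _ "[P, Q]"]) (simp add: ec_points_def)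
qed

end
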